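(* In LP$^{\mathrm{MLN}}$ (i.e. with respect to semi-strong equivalence $\equiv_{s,s}$), the S-RP transformation is both SE-preserving and NSE-preserving.
   Context: Atoms are propositional. A rule $r$ is an expression $h_1\vee\cdots\vee h_k\leftarrow b_1,\dots,b_m,\mathit{not}\,c_1,\dots,\mathit{not}\,c_n$ ($k,m,n\ge 0$) with atoms $h_i,b_i,c_i$; write $H(r)=\{h_1,\dots,h_k\}$, $B^+(r)=\{b_1,\dots,b_m\}$, $B^-(r)=\{c_1,\dots,c_n\}$. A program is a finite set of rules. An interpretation is a set $X$ of atoms; $X\models r$ iff $X\cap H(r)\neq\emptyset$ or $B^+(r)\not\subseteq X$ or $B^-(r)\cap X\neq\emptyset$; $X\models P$ iff $X$ satisfies every rule of $P$. The GL-reduct is $P^X=\{H(r)\leftarrow B^+(r) : r\in P,\ B^-(r)\cap X=\emptyset\}$; $X$ is an ASP stable model of $P$ iff $X\models P^X$ and no proper subset of $X$ satisfies $P^X$. LP$^{\mathrm{MLN}}$ rules carry weights, but weights are irrelevant here and omitted, so an LP$^{\mathrm{MLN}}$ program is just a program; $X$ is an LP$^{\mathrm{MLN}}$ stable model of $P$ iff $X$ is an ASP stable model of $P_X=\{r\in P: X\models r\}$. Programs $P,Q$ are semi-strongly equivalent, $P\equiv_{s,s}Q$, iff for every program $R$, $P\cup R$ and $Q\cup R$ have the same LP$^{\mathrm{MLN}}$ stable models. Tuples and independent sets: programs are regarded as tuples of rules (repetitions allowed); for $P=\langle r_1,\dots,r_p\rangle$, $Q=\langle t_1,\dots,t_q\rangle$,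 $\langle P,Q\rangle=\langle r_1,\dots,r_p,t_1,\dots,t_q\rangle$. For a tuple $T=\langle r_1,\dots,r_n\rangle$ let $at(T)$ be its set of atoms and $\langle S_1,\dots,S_{3n}\rangle=\langle H(r_1),B^+(r_1),B^-(r_1),\dots,H(r_n),B^+(r_n),B^-(r_n)\rangle$. For each nonempty $N'\subseteq\{1,\dots,3n\}$ the independent set is $I_{N'}=\bigcap_{i\in N'}S_i\setminus\bigcup_{j\in\{1,\dots,3n\}\setminus N'}S_j$; it is named $I_k$ with $k=\sum_{i\in N'}2^{3n-i}$, $1\le k<2^{3n}$. Independent sets are pairwise disjoint and cover $at(T)$. S-* transformations: let $I_k=I_{N'}$ be an independent set of $T$ and $a'\notin at(T)$ a fresh atom. Replacing $a\in I_k$ by $a'$ means renaming every occurrence of $a$ in $T$ to $a'$; deleting $a\in I_k$ means removing $a$ from every rule of $T$; adding $a'$ to $I_k$ means adding $a'$ to each $S_i$ with $i\in N'$. S-RP: replace some $a\in I_k$ by $a'$ (requires $|I_k|>0$); S-DL: delete some $a\in I_k$, requires $|I_k|>2$; S-RD-$i$ ($i\in\{1,2\}$): delete some $a\in I_k$, requires $|I_k|=i$; S-AD: add $a'$ to $I_k$, requires $|I_k|\ge 2$; S-EX-$i$ ($i\in\{0,1\}$): add $a'$ to $I_k$, requires $|I_k|=i$. For a pair $T=\langle P,Q\rangle$ the result is $T^\circ=\langle P^\circ,Q^\circ\rangle$ where $P^\circ$ consists of the first $|P|$ rules. For a given equivalence $\equiv$, a transformation type is SE-preserving if for every pair $\langle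 P,Q\rangle$ and every admissible application, $P\equiv Q$ implies $P^\circ\equiv Q^\circ$; it is NSE-preserving if $P\not\equiv Q$ implies $P^\circ\not\equiv Q^\circ$. *)

theory Defs
  imports Main "HOL-Library.FSet"
begin

datatype 'a rule =
  Rule (head: "'a fset") (pos_body: "'a fset") (neg_body: "'a fset")

definition satisfies_rule :: "'a set \<Rightarrow> 'a rule \<Rightarrow> bool" where
  "satisfies_rule X r \<longleftrightarrow>
     X \<inter> fset (head r) \<noteq> {} \<or> \<not> fset (pos_body r) \<subseteq> X \<or> fset (neg_body r) \<inter> X \<noteq> {}"

definition satisfies :: "'a set \<Rightarrow> 'a rule set \<Rightarrow> bool" where
  "satisfies X P \<longleftrightarrow> (\<forall>r\<in>P. satisfies_rule X r)"

definition GL_reduct :: "'a rule set \<Rightarrow> 'a set \<Rightarrow> 'a rule set" where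
  "GL_reduct P X =
     {Rule (head r) (pos_body r) {||} | r. r \<in> P \<and> fset (neg_body r) \<inter> X = {}}"

definition ASP_stable_model :: "'a rule set \<Rightarrow> 'a set \<Rightarrow> bool" where
  "ASP_stable_model P X \<longleftrightarrow>
     satisfies X (GL_reduct P X) \<and> \<not> (\<exists>Y. Y \<subset> X \<and> satisfies Y (GL_reduct P X))"

definition LPMLN_stable_model :: "'a rule set \<Rightarrow> 'a set \<Rightarrow> bool" where
  "LPMLN_stable_model P X \<longleftrightarrow> ASP_stable_model {r \<in> P. satisfies_rule X r} X"

definition semi_strongly_equivalent :: "'a rule set \<Rightarrow> 'a rule set \<Rightarrow> bool" where
  "semi_strongly_equivalent P Q \<longleftrightarrow>
     (\<forall>R. finite R \<longrightarrow>
        {X. LPMLN_stable_model (P \<union> R) X} = {X. LPMLN_stable_model (Q \<union> R) X})"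

text \<open>Tuples of rules are lists; the program denoted by a tuple \<open>T\<close> is \<open>set T\<close>.\<close>

definition atoms :: "'a rule list \<Rightarrow> 'a set" where
  "atoms T = (\<Union>r\<in>set T. fset (head r) \<union> fset (pos_body r) \<union> fset (neg_body r))"

text \<open>\<open>component T i\<close> is the set \<open>S\<^sub>i\<close>; indices run from \<open>1\<close> to \<open>3 * length T\<close>.\<close>

definition component :: "'a rule list \<Rightarrow> nat \<Rightarrow> 'a set" where
  "component T i =
     concat (map (\<lambda>r. [fset (head r), fset (pos_body r), fset (neg_body r)]) T) ! (i - 1)"

definition independent_set :: "'a rule list \<Rightarrow> nat set \<Rightarrow> 'a set" where
  "independent_set T N =
     (\<Inter>i\<in>N. component T i) - (\<Union>j\<in>{1..3 * length T} - N. component T j)"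

definition replace_atom :: "'a \<Rightarrow> 'a \<Rightarrow> 'a rule list \<Rightarrow> 'a rule list" where
  "replace_atom a a' T = map (map_rule (\<lambda>x. if x = a then a' else x)) T"

text \<open>
  A transformation type is the relation between a tuple and its possible results.
\<close>

definition S_RP :: "'a rule list \<Rightarrow> 'a rule list \<Rightarrow> bool" where
  "S_RP T T' \<longleftrightarrow>
     (\<exists>N a a'. N \<noteq> {} \<and> N \<subseteq> {1..3 * length T} \<and> card (independent_set T N) > 0 \<and>
        a \<in> independent_set T N \<and> a' \<notin> atoms T \<and> T' = replace_atom a a' T)"

definition SE_preserving ::
  "('a rule set \<Rightarrow> 'a rule set \<Rightarrow> bool) \<Rightarrow> ('a rule list \<Rightarrow> 'a rule list \<Rightarrow> bool) \<Rightarrow> bool" where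
  "SE_preserving eqv tr \<longleftrightarrow>
     (\<forall>P Q T'. tr (P @ Q) T' \<longrightarrow> eqv (set P) (set Q) \<longrightarrow>
        eqv (set (take (length P) T')) (set (drop (length P) T')))"

definition NSE_preserving ::
  "('a rule set \<Rightarrow> 'a rule set \<Rightarrow> bool) \<Rightarrow> ('a rule list \<Rightarrow> 'a rule list \<Rightarrow> bool) \<Rightarrow> bool" where
  "NSE_preserving eqv tr \<longleftrightarrow>
     (\<forall>P Q T'. tr (P @ Q) T' \<longrightarrow> \<not> eqv (set P) (set Q) \<longrightarrow>
        \<not> eqv (set (take (length P) T')) (set (drop (length P) T')))"

end

theory Submission
  imports Defs "HOL-Combinatorics.Transposition"
begin

text \<open>
  Stable models commute with injective renamings of atoms, so semi-strong equivalence is invariant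
  under bijective ones. Replacing \<open>a\<close> by a fresh \<open>a'\<close> is not injective on all atoms, and a program
  \<open>R\<close> added to the tuple may mention \<open>a'\<close>; but on the rules of the tuple itself the replacement agrees
  with the transposition of \<open>a\<close> and \<open>a'\<close>, which is bijective.
\<close>

lemma inj_image_Int_eq_empty_iff:
  assumes "inj f"
  shows "f ` A \<inter> f ` B = {} \<longleftrightarrow> A \<inter> B = {}"
  by (simp add: image_Int[OF assms, symmetric])

lemma psubset_inj_on_image_iff:
  assumes "inj_on f X"
  shows "Y \<subset> f ` X \<longleftrightarrow> (\<exists>Z. Z \<subset> X \<and> Y = f ` Z)"
proof
  assume "Y \<subset> f ` X"
  then obtain Z where "Z \<subseteq> X" "Y = f ` Z"
    by (auto simp: psubset_eq subset_image_iff)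
  with \<open>Y \<subset> f ` X\<close> show "\<exists>Z. Z \<subset> X \<and> Y = f ` Z"
    by blast
next
  assume "\<exists>Z. Z \<subset> X \<and> Y = f ` Z"
  then obtain Z where "Z \<subset> X" and "Y = f ` Z"
    by blast
  then show "Y \<subset> f ` X"
    by (simp add: image_strict_mono[OF assms])
qed

lemma satisfies_rule_map_rule:
  assumes "inj f"
  shows "satisfies_rule (f ` X) (map_rule f r) \<longleftrightarrow> satisfies_rule X r"
  by (simp add: satisfies_rule_def rule.map_sel inj_image_Int_eq_empty_iff[OF assms]
      inj_image_subset_iff[OF assms])

lemma satisfies_map_rule:
  assumes "inj f"
  shows "satisfies (f ` X) (map_rule f ` P) \<longleftrightarrow> satisfies X P"
  by (simp add: satisfies_def satisfies_rule_map_rule[OF assms])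

definition positive_part :: "'a rule \<Rightarrow> 'a rule" where
  "positive_part r = Rule (head r) (pos_body r) {||}"

lemma positive_part_map_rule: "positive_part (map_rule f r) = map_rule f (positive_part r)"
  by (simp add: positive_part_def rule.map_sel)

lemma GL_reduct_eq_image:
  "GL_reduct P X = positive_part ` {r \<in> P. fset (neg_body r) \<inter> X = {}}"
  by (auto simp: GL_reduct_def positive_part_def)

lemma GL_reduct_map_rule:
  assumes "inj f"
  shows "GL_reduct (map_rule f ` P) (f ` X) = map_rule f ` GL_reduct P X"
  by (simp add: GL_reduct_eq_image Compr_image_eq image_image positive_part_map_rule rule.map_sel
      inj_image_Int_eq_empty_iff[OF assms])

lemma ASP_stable_model_map_rule:
  assumes "inj f"
  shows "ASP_stable_model (map_rule f ` P) (f ` X) \<longleftrightarrow> ASP_stable_model P X"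
proof -
  have "(\<exists>Y. Y \<subset> f ` X \<and> satisfies Y (map_rule f ` GL_reduct P X)) \<longleftrightarrow>
      (\<exists>Z. Z \<subset> X \<and> satisfies (f ` Z) (map_rule f ` GL_reduct P X))"
    using psubset_inj_on_image_iff[OF inj_on_subset[OF assms subset_UNIV]] by metis
  also have "\<dots> \<longleftrightarrow> (\<exists>Z. Z \<subset> X \<and> satisfies Z (GL_reduct P X))"
    by (simp add: satisfies_map_rule[OF assms])
  finally show ?thesis
    by (simp add: ASP_stable_model_def GL_reduct_map_rule[OF assms] satisfies_map_rule[OF assms])
qed

lemma LPMLN_stable_model_map_rule:
  assumes "inj f"
  shows "LPMLN_stable_model (map_rule f ` P) (f ` X) \<longleftrightarrow> LPMLN_stable_model P X"
  by (simp add: LPMLN_stable_model_def Compr_image_eq satisfies_rule_map_rule[OF assms]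
      ASP_stable_model_map_rule[OF assms])

lemma semi_strongly_equivalent_iff:
  "semi_strongly_equivalent P Q \<longleftrightarrow>
    (\<forall>R X. finite R \<longrightarrow> (LPMLN_stable_model (P \<union> R) X \<longleftrightarrow> LPMLN_stable_model (Q \<union> R) X))"
  by (auto simp: semi_strongly_equivalent_def set_eq_iff)

lemma semi_strongly_equivalent_map_ruleD:
  assumes "inj f" and "semi_strongly_equivalent (map_rule f ` P) (map_rule f ` Q)"
  shows "semi_strongly_equivalent P Q"
  unfolding semi_strongly_equivalent_iff
proof (intro allI impI)
  fix R :: "'a rule set" and X :: "'a set"
  assume "finite R"
  have renamed: "LPMLN_stable_model (S \<union> R) X \<longleftrightarrow>
      LPMLN_stable_model (map_rule f ` S \<union> map_rule f ` R) (f ` X)" for S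
    by (simp add: LPMLN_stable_model_map_rule[OF assms(1)] image_Un[symmetric])
  show "LPMLN_stable_model (P \<union> R) X \<longleftrightarrow> LPMLN_stable_model (Q \<union> R) X"
    using assms(2) \<open>finite R\<close> by (simp add: renamed semi_strongly_equivalent_iff)
qed

definition renaming_invariant :: "('a rule set \<Rightarrow> 'a rule set \<Rightarrow> bool) \<Rightarrow> bool" where
  "renaming_invariant eqv \<longleftrightarrow>
    (\<forall>f P Q. bij f \<longrightarrow> eqv (map_rule f ` P) (map_rule f ` Q) = eqv P Q)"

lemma renaming_invariant_semi_strongly_equivalent: "renaming_invariant semi_strongly_equivalent"
  unfolding renaming_invariant_def
proof (intro allI impI iffI)
  fix f :: "'a \<Rightarrow> 'a" and P Q :: "'a rule set"
  assume "bij f"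
  then have "inj f" and "inj (inv f)"
    by (simp_all add: bij_is_inj bij_imp_bij_inv)
  have inverse_renaming: "map_rule (inv f) ` map_rule f ` S = S" for S
    using \<open>inj f\<close> by (simp add: image_image rule.map_comp rule.map_id)
  show "semi_strongly_equivalent P Q"
    if "semi_strongly_equivalent (map_rule f ` P) (map_rule f ` Q)"
    using \<open>inj f\<close> that by (rule semi_strongly_equivalent_map_ruleD)
  show "semi_strongly_equivalent (map_rule f ` P) (map_rule f ` Q)"
    if "semi_strongly_equivalent P Q"
    using \<open>inj (inv f)\<close>
  proof (rule semi_strongly_equivalent_map_ruleD)
    show "semi_strongly_equivalent (map_rule (inv f) ` map_rule f ` P)
        (map_rule (inv f) ` map_rule f ` Q)"
      using that by (simp only: inverse_renaming)
  qed
qed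

lemma atoms_eq_UN_set_rule: "atoms T = (\<Union>r\<in>set T. set_rule r)"
proof -
  have "set_rule r = fset (head r) \<union> fset (pos_body r) \<union> fset (neg_body r)" for r :: "'a rule"
    by (cases r) simp
  then show ?thesis
    by (simp add: atoms_def)
qed

lemma replace_atom_eq_map_transpose:
  assumes "a' \<notin> atoms T"
  shows "replace_atom a a' T = map (map_rule (transpose a a')) T"
  unfolding replace_atom_def
proof (rule map_cong[OF refl], rule rule.map_cong0)
  fix r x
  assume "r \<in> set T" and "x \<in> set_rule r"
  with assms have "x \<noteq> a'"
    by (auto simp: atoms_eq_UN_set_rule)
  then show "(if x = a then a' else x) = transpose a a' x"
    by (simp add: transpose_def)
qed

lemma S_RP_imp_bij_renaming:
  assumes "S_RP T T'"
  obtains f where "bij f" and "T' = map (map_rule f) T"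
proof -
  obtain a a' where "a' \<notin> atoms T" and "T' = replace_atom a a' T"
    using assms by (auto simp: S_RP_def)
  then show thesis
    using that[of "transpose a a'"] by (simp add: replace_atom_eq_map_transpose)
qed

lemma renaming_invariant_S_RP_iff:
  assumes "renaming_invariant eqv" and "S_RP (P @ Q) T'"
  shows "eqv (set (take (length P) T')) (set (drop (length P) T')) \<longleftrightarrow> eqv (set P) (set Q)"
proof -
  obtain f where "bij f" and "T' = map (map_rule f) (P @ Q)"
    using assms(2) by (rule S_RP_imp_bij_renaming)
  then show ?thesis
    using assms(1) by (simp add: renaming_invariant_def)
qed

theorem theorem2:
  "SE_preserving (semi_strongly_equivalent :: 'a rule set \<Rightarrow> 'a rule set \<Rightarrow> bool) S_RP \<and>
   NSE_preserving (semi_strongly_equivalent :: 'a rule set \<Rightarrow> 'a rule set \<Rightarrow> bool) S_RP"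
  by (simp add: SE_preserving_def NSE_preserving_def
      renaming_invariant_S_RP_iff[OF renaming_invariant_semi_strongly_equivalent])

end
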